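(* Let $(\mathscr{A},\{\cdot,\cdot\})$ be a Poisson $C^\infty$-ring and $\mathscr{I}\subset\mathscr{A}$ an ideal in the commutative $\mathbb{R}$-algebra underlying $\mathscr{A}$. The normalizer $N(\mathscr{I})$ of $\mathscr{I}$ is a $C^\infty$-subring of $\mathscr{A}$. Consequently $$\mathscr{B} := N(\mathscr{I})/(\mathscr{I}\cap N(\mathscr{I}))$$ is a Poisson $C^\infty$-ring (with the bracket induced from that of $\mathscr{A}$).
   Context: A $C^\infty$-ring is a set $\mathscr{A}$ with an operation $f_{\mathscr{A}}:\mathscr{A}^n\to\mathscr{A}$ for each $n\geq 0$ and each $f\in C^\infty(\mathbb{R}^n)$, compatible with composition of smooth functions and sending coordinate functions to projections. It has an underlying commutative unital $\mathbb{R}$-algebra. A $C^\infty$-subring is a subset closed under all operations. For an ideal $I$ of the underlying $\mathbb{R}$-algebra, $\mathscr{A}/I$ is a $C^\infty$-ring with $f_{\mathscr{A}/I}(a_1+I,\ldots,a_n+I)=f_{\mathscr{A}}(a_1,\ldots,a_n)+I$. A Poisson $C^\infty$-ring is a $C^\infty$-ring $\mathscr{A}$ with a Poisson bracket on the underlying $\mathbb{R}$-algebra such that for each $a\in\mathscr{A}$ one has $\{a, f_{\mathscr{A}}(a_1,\ldots,a_n)\} = \sum_{i=1}^n (\partial_i f)_{\mathscr{A}}(a_1,\ldots,a_n)\cdot\{a,a_i\}$ for all $n>0$, $f\in C^\infty(\mathbb{R}^n)$, $a_1,\dots,a_n\in\mathscr{A}$. The normalizer of a subset $S\subset\mathscr{A}$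 is $N(S)=\{a\in\mathscr{A}\mid \{s,a\}\in S\text{ for all }s\in S\}$. *)

theory Defs
  imports "HOL-Analysis.Analysis" "HOL-Algebra.QuotRing" "HOL-Algebra.Module"
begin

section \<open>Smooth functions on \<open>\<real>\<^sup>n\<close>\<close>

text \<open>
  The arity \<open>n\<close> varies over all natural numbers, so a point of \<open>\<real>\<^sup>n\<close> is given by the coordinates
  \<open>x 0, \<dots>, x (n - 1)\<close> of a function \<open>x :: nat \<Rightarrow> real\<close>, and a function on \<open>\<real>\<^sup>n\<close> is a function of
  \<open>x\<close> that depends on these coordinates only.  For such functions continuity with respect to the
  product topology on \<open>nat \<Rightarrow> real\<close> is the usual continuity on \<open>\<real>\<^sup>n\<close>.
\<close>

definition depends_on_first :: "nat \<Rightarrow> ((nat \<Rightarrow> real) \<Rightarrow> real) \<Rightarrow> bool" where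
  "depends_on_first n f \<longleftrightarrow> (\<forall>x y. (\<forall>i<n. x i = y i) \<longrightarrow> f x = f y)"

definition partial_deriv :: "nat \<Rightarrow> ((nat \<Rightarrow> real) \<Rightarrow> real) \<Rightarrow> (nat \<Rightarrow> real) \<Rightarrow> real" where
  "partial_deriv i f x = deriv (\<lambda>t. f (x(i := t))) (x i)"

text \<open>
  \<open>C\<^sup>\<infinity>(\<real>\<^sup>n)\<close>: all iterated partial derivatives, including the function itself, exist and are
  continuous.  The list \<open>is\<close> records the directions of differentiation.
\<close>

definition Cinf :: "nat \<Rightarrow> ((nat \<Rightarrow> real) \<Rightarrow> real) set" where
  "Cinf n = {f. depends_on_first n f \<and>
     (\<forall>is. set is \<subseteq> {..<n} \<longrightarrow>
        continuous_on UNIV (fold partial_deriv is f) \<and>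
        (\<forall>i<n. \<forall>x. (\<lambda>t. fold partial_deriv is f (x(i := t))) field_differentiable (at (x i))))}"


section \<open>\<open>C\<^sup>\<infinity>\<close>-rings\<close>

text \<open>
  \<open>cop A f [a\<^sub>1, \<dots>, a\<^sub>n]\<close> is the operation \<open>f\<^sub>A : A\<^sup>n \<rightarrow> A\<close> for \<open>f \<in> C\<^sup>\<infinity>(\<real>\<^sup>n)\<close>; the arity is the length of
  the list, so that a function \<open>f\<close> that is regarded as an element of both \<open>C\<^sup>\<infinity>(\<real>\<^sup>n)\<close> and
  \<open>C\<^sup>\<infinity>(\<real>\<^sup>n\<^sup>+\<^sup>1)\<close> still gives two separate operations.
\<close>

record 'a cinf_struct = "'a partial_object" +
  cop :: "((nat \<Rightarrow> real) \<Rightarrow> real) \<Rightarrow> 'a list \<Rightarrow> 'a"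

locale cinf_ring =
  fixes A :: "('a, 'b) cinf_struct_scheme" (structure)
  assumes cop_closed:
      "\<lbrakk>f \<in> Cinf (length as); set as \<subseteq> carrier A\<rbrakk> \<Longrightarrow> cop A f as \<in> carrier A"
    and cop_coord:
      "\<lbrakk>set as \<subseteq> carrier A; i < length as\<rbrakk> \<Longrightarrow> cop A (\<lambda>x. x i) as = as ! i"
    and cop_comp:
      "\<lbrakk>f \<in> Cinf (length gs); set gs \<subseteq> Cinf (length as); set as \<subseteq> carrier A\<rbrakk> \<Longrightarrow>
         cop A f (map (\<lambda>g. cop A g as) gs) = cop A (\<lambda>x. f (\<lambda>i. (gs ! i) x)) as"

definition cinf_subring :: "'a set \<Rightarrow> ('a, 'b) cinf_struct_scheme \<Rightarrow> bool" where
  "cinf_subring S A \<longleftrightarrow> S \<subseteq> carrier A \<and>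
     (\<forall>f as. f \<in> Cinf (length as) \<longrightarrow> set as \<subseteq> S \<longrightarrow> cop A f as \<in> S)"

text \<open>The underlying commutative unital \<open>\<real>\<close>-algebra.\<close>

definition cinf_alg :: "('a, 'b) cinf_struct_scheme \<Rightarrow> (real, 'a) module" where
  "cinf_alg A =
     \<lparr>carrier = carrier A,
      mult = (\<lambda>a b. cop A (\<lambda>x. x 0 * x 1) [a, b]),
      one = cop A (\<lambda>_. 1) [],
      zero = cop A (\<lambda>_. 0) [],
      add = (\<lambda>a b. cop A (\<lambda>x. x 0 + x 1) [a, b]),
      smult = (\<lambda>r a. cop A (\<lambda>x. r * x 0) [a])\<rparr>"


section \<open>Poisson \<open>C\<^sup>\<infinity>\<close>-rings\<close>

text \<open>A Poisson bracket: an \<open>\<real>\<close>-bilinear Lie bracket that is a derivation in each argument (the second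
  one suffices by skew-symmetry).\<close>

locale poisson_bracket =
  fixes M :: "(real, 'a, 'm) module_scheme" (structure) and br :: "'a \<Rightarrow> 'a \<Rightarrow> 'a"
  assumes br_closed: "\<lbrakk>a \<in> carrier M; b \<in> carrier M\<rbrakk> \<Longrightarrow> br a b \<in> carrier M"
    and br_add_left: "\<lbrakk>a \<in> carrier M; b \<in> carrier M; c \<in> carrier M\<rbrakk> \<Longrightarrow>
          br (a \<oplus> b) c = br a c \<oplus> br b c"
    and br_add_right: "\<lbrakk>a \<in> carrier M; b \<in> carrier M; c \<in> carrier M\<rbrakk> \<Longrightarrow>
          br a (b \<oplus> c) = br a b \<oplus> br a c"
    and br_smult_left: "\<lbrakk>a \<in> carrier M; b \<in> carrier M\<rbrakk> \<Longrightarrow> br (r \<odot> a) b = r \<odot> br a b"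
    and br_smult_right: "\<lbrakk>a \<in> carrier M; b \<in> carrier M\<rbrakk> \<Longrightarrow> br a (r \<odot> b) = r \<odot> br a b"
    and br_skew: "\<lbrakk>a \<in> carrier M; b \<in> carrier M\<rbrakk> \<Longrightarrow> br a b = \<ominus> br b a"
    and br_jacobi: "\<lbrakk>a \<in> carrier M; b \<in> carrier M; c \<in> carrier M\<rbrakk> \<Longrightarrow>
          br a (br b c) \<oplus> br b (br c a) \<oplus> br c (br a b) = \<zero>"
    and br_leibniz: "\<lbrakk>a \<in> carrier M; b \<in> carrier M; c \<in> carrier M\<rbrakk> \<Longrightarrow>
          br a (b \<otimes> c) = br a b \<otimes> c \<oplus> b \<otimes> br a c"

record 'a poisson_struct = "'a cinf_struct" +
  bracket :: "'a \<Rightarrow> 'a \<Rightarrow> 'a"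

locale poisson_cinf_ring = cinf_ring A + poisson_bracket "cinf_alg A" "bracket A"
  for A :: "('a, 'b) poisson_struct_scheme" (structure) +
  assumes bracket_cop:
      "\<lbrakk>a \<in> carrier A; as \<noteq> []; set as \<subseteq> carrier A; f \<in> Cinf (length as)\<rbrakk> \<Longrightarrow>
         bracket A a (cop A f as) =
           (\<Oplus>\<^bsub>cinf_alg A\<^esub>i\<in>{..<length as}.
              cop A (partial_deriv i f) as \<otimes>\<^bsub>cinf_alg A\<^esub> bracket A a (as ! i))"

definition normalizer :: "('a, 'b) poisson_struct_scheme \<Rightarrow> 'a set \<Rightarrow> 'a set" where
  "normalizer A S = {a \<in> carrier A. \<forall>s\<in>S. bracket A s a \<in> S}"

text \<open>
  The structure induced on the additive cosets of \<open>J\<close>.  Operation and bracket are formed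
  representative-wise, as \<^const>\<open>rcoset_mult\<close> does it for the multiplication of a quotient ring: the
  union ranges over all representatives and is a single coset exactly when the result is
  independent of the representatives.
\<close>

definition poisson_quot :: "('a, 'b) poisson_struct_scheme \<Rightarrow> 'a set \<Rightarrow> 'a set poisson_struct" where
  "poisson_quot A J =
     \<lparr>carrier = a_rcosets\<^bsub>cinf_alg A\<^esub> J,
      cop = (\<lambda>f Xs. \<Union>as\<in>{as. list_all2 (\<in>) as Xs}. J +>\<^bsub>cinf_alg A\<^esub> cop A f as),
      bracket = (\<lambda>X Y. \<Union>a\<in>X. \<Union>b\<in>Y. J +>\<^bsub>cinf_alg A\<^esub> bracket A a b)\<rparr>"

end

theory Submission
  imports Defs
begin

text \<open>
  Let \<open>N\<close> be the normalizer of the ideal \<open>I\<close>.  For \<open>s \<in> I\<close> the map \<open>{s, \<cdot>}\<close> obeys the chain rule, so it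
  sends \<open>f(a\<^sub>1, \<dots>, a\<^sub>n)\<close> to a linear combination of the \<open>{s, a\<^sub>i}\<close>; if all \<open>a\<^sub>i\<close> lie in \<open>N\<close>, this
  combination lies in \<open>I\<close>.  Hence \<open>N\<close> is a \<open>C\<^sup>\<infinity>\<close>-subring (\<open>normalizer_cinf_subring\<close>).  By the Jacobi
  identity it is closed under the bracket (\<open>normalizer_bracket_closed\<close>), so \<open>N\<close> is itself a Poisson
  \<open>C\<^sup>\<infinity>\<close>-ring (\<open>poisson_subring\<close>), and \<open>J = I \<inter> N\<close> is an ideal of \<open>N\<close> with \<open>{J, N} \<subseteq> J\<close>.

  It remains to divide a Poisson \<open>C\<^sup>\<infinity>\<close>-ring by such a Poisson ideal.  That the bracket descends is
  bilinear algebra (\<open>bracket_coset_cong\<close>).  That every smooth operation descends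
  (\<open>cop_coset_cong\<close>) is the analytic core: by Hadamard's lemma,
  \<open>f(x + y e\<^sub>i) = f(x) + y g(x, y)\<close> with \<open>g(x, y) = \<integral>\<^sub>0\<^sup>1 (\<partial>\<^sub>i f)(x + t y e\<^sub>i) dt\<close>, where \<open>g\<close> is smooth in
  \<open>n + 1\<close> variables (\<open>Cinf_segment_moment\<close>, \<open>Hadamard\<close>).  Applying this identity to elements of the
  ring shows that changing the \<open>i\<close>-th argument by \<open>c \<in> J\<close> changes the value by a multiple of \<open>c\<close>
  (\<open>cop_perturb\<close>).  With that, cosets form a \<open>C\<^sup>\<infinity>\<close>-ring, and the Poisson axioms
  of the quotient follow from those upstairs, since the coset map is a surjective homomorphism (\<open>poisson_cinf_ring_image\<close>).

  Throughout, identities of the underlying \<open>\<real>\<close>-algebra, including the ring axioms themselves, are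
  identities between polynomial functions transported by the compatibility with composition.
\<close>

section \<open>Smooth functions\<close>

text \<open>
  Smoothness is the greatest property that implies continuity and partial differentiability and is
  inherited by all partial derivatives.  So to see that \<open>f\<close> is smooth it is enough to find a class of
  functions around \<open>f\<close> that is closed under partial derivatives and whose members are continuous and
  partially differentiable; no formula for iterated derivatives is needed.
\<close>
lemma Cinf_coinduct:
  assumes "f \<in> F"
    and dep: "\<And>g. g \<in> F \<Longrightarrow> depends_on_first n g"
    and cont: "\<And>g. g \<in> F \<Longrightarrow> continuous_on UNIV g"
    and deriv: "\<And>g i x. g \<in> F \<Longrightarrow> i < n \<Longrightarrow> \<exists>D. ((\<lambda>t. g (x(i := t))) has_field_derivative D) (at (x i))"
    and closed: "\<And>g i. g \<in> F \<Longrightarrow> i < n \<Longrightarrow> partial_deriv i g \<in> F"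
  shows "f \<in> Cinf n"
proof -
  have fold_in: "fold partial_deriv is f \<in> F" if "set is \<subseteq> {..<n}" for "is"
    using \<open>f \<in> F\<close> that by (induction "is" arbitrary: f) (auto intro: closed)
  show ?thesis
    unfolding Cinf_def
    using \<open>f \<in> F\<close> fold_in by (auto intro: dep cont simp: field_differentiable_def deriv)
qed

lemma Cinf_depends: "f \<in> Cinf n \<Longrightarrow> (\<And>i. i < n \<Longrightarrow> x i = y i) \<Longrightarrow> f x = f y"
  unfolding Cinf_def depends_on_first_def by blast

lemma Cinf_continuous: "f \<in> Cinf n \<Longrightarrow> continuous_on UNIV f"
  unfolding Cinf_def by (auto dest: spec[where x="[]"])

lemma Cinf_has_partial_deriv:
  assumes "f \<in> Cinf n" "i < n"
  shows "((\<lambda>t. f (x(i := t))) has_field_derivative partial_deriv i f (x(i := s))) (at s)"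
proof -
  have "\<forall>y. (\<lambda>t. fold partial_deriv [] f (y(i := t))) field_differentiable at (y i)"
    using assms unfolding Cinf_def mem_Collect_eq by (metis empty_set empty_subsetI)
  then have "(\<lambda>t. f (x(i := t))) field_differentiable at s"
    by (auto dest: spec[of _ "x(i := s)"])
  then show ?thesis
    by (simp add: partial_deriv_def DERIV_deriv_iff_field_differentiable)
qed

lemma partial_deriv_eqI:
  assumes "\<And>x. ((\<lambda>t. f (x(i := t))) has_field_derivative g x) (at (x i))"
  shows "partial_deriv i f = g"
  using assms by (auto simp: partial_deriv_def fun_eq_iff intro: DERIV_imp_deriv)

lemma Cinf_partial_deriv:
  assumes "f \<in> Cinf n" "i < n"
  shows "partial_deriv i f \<in> Cinf n"
proof -
  have "depends_on_first n (partial_deriv i f)"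
    unfolding depends_on_first_def
  proof (intro allI impI)
    fix x y :: "nat \<Rightarrow> real" assume eq: "\<forall>i<n. x i = y i"
    then have "(\<lambda>t. f (x(i := t))) = (\<lambda>t. f (y(i := t)))"
      by (intro ext Cinf_depends[OF assms(1)]) auto
    then show "partial_deriv i f x = partial_deriv i f y"
      using eq assms(2) by (simp add: partial_deriv_def)
  qed
  moreover have "continuous_on UNIV (fold partial_deriv is (partial_deriv i f)) \<and>
        (\<forall>k<n. \<forall>x. (\<lambda>t. fold partial_deriv is (partial_deriv i f) (x(k := t)))
           field_differentiable (at (x k)))" if "set is \<subseteq> {..<n}" for "is"
    using assms that unfolding Cinf_def by (auto dest!: spec[where x="i # is"])
  ultimately show ?thesis
    unfolding Cinf_def by blast
qed

lemma partial_deriv_outside: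
  assumes "f \<in> Cinf n" "n \<le> i"
  shows "partial_deriv i f = (\<lambda>_. 0)"
proof (rule partial_deriv_eqI)
  fix x
  have "(\<lambda>t. f (x(i := t))) = (\<lambda>t. f x)"
    by (intro ext Cinf_depends[OF assms(1)]) (use assms(2) in auto)
  then show "((\<lambda>t. f (x(i := t))) has_field_derivative 0) (at (x i))" by simp
qed

lemma partial_deriv_const: "partial_deriv i (\<lambda>_. c) = (\<lambda>_. 0)"
  by (rule partial_deriv_eqI) auto

lemma Cinf_const: "(\<lambda>_. c) \<in> Cinf n"
  by (rule Cinf_coinduct[where F="range (\<lambda>c _. c)"])
    (auto simp: depends_on_first_def partial_deriv_const intro!: exI[of _ 0])

lemma partial_deriv_coord: "partial_deriv i (\<lambda>x. x k) = (\<lambda>_. if i = k then 1 else 0)"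
  by (rule partial_deriv_eqI) auto

lemma Cinf_coord: 
  assumes "k < n" shows "(\<lambda>x. x k) \<in> Cinf n"
proof (rule Cinf_coinduct[where F="insert (\<lambda>x. x k) (range (\<lambda>c _. c))"])
  fix g :: "(nat \<Rightarrow> real) \<Rightarrow> real" and i x assume "g \<in> insert (\<lambda>x. x k) (range (\<lambda>c _. c))"
  then show "\<exists>D. ((\<lambda>t. g (x(i := t))) has_field_derivative D) (at (x i))"
    by (cases "i = k") (auto intro: exI[of _ 0] exI[of _ 1])
qed (use assms in \<open>auto simp: depends_on_first_def partial_deriv_coord partial_deriv_const\<close>)

text \<open>A smooth function of \<open>m\<close> variables, read as a function of more variables, has vanishing partial
  derivatives in the new directions.\<close>
lemma Cinf_mono:
  assumes "f \<in> Cinf m" "m \<le> n"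
  shows "f \<in> Cinf n"
proof (rule Cinf_coinduct[where F="Cinf m"])
  fix g i x assume g: "g \<in> Cinf m"
  show "depends_on_first n g"
    unfolding depends_on_first_def using Cinf_depends[OF g] assms(2) by (meson order.strict_trans2)
  show "continuous_on UNIV g"
    by (rule Cinf_continuous[OF g])
  show "partial_deriv i g \<in> Cinf m"
    using Cinf_partial_deriv[OF g] partial_deriv_outside[OF g] Cinf_const[of 0 m]
    by (cases "i < m") (simp_all del: fun_upd_apply)
  show "\<exists>D. ((\<lambda>t. g (x(i := t))) has_field_derivative D) (at (x i))"
  proof (cases "i < m")
    case True
    then show ?thesis using Cinf_has_partial_deriv[OF g] by blast
  next
    case False
    have "(\<lambda>t. g (x(i := t))) = (\<lambda>t. g x)"
      by (intro ext Cinf_depends[OF g]) (use False in auto)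
    then show ?thesis by (auto intro!: exI[of _ 0])
  qed
qed (use assms in auto)

text \<open>
  A product of smooth functions has sums of products as its derivatives, so the class to which
  coinduction applies has to contain all polynomial expressions in smooth functions.
\<close>
inductive_set Cinf_span :: "nat \<Rightarrow> ((nat \<Rightarrow> real) \<Rightarrow> real) set" for n where
  base: "f \<in> Cinf n \<Longrightarrow> f \<in> Cinf_span n"
| add: "f \<in> Cinf_span n \<Longrightarrow> g \<in> Cinf_span n \<Longrightarrow> (\<lambda>x. f x + g x) \<in> Cinf_span n"
| mult: "f \<in> Cinf_span n \<Longrightarrow> g \<in> Cinf_span n \<Longrightarrow> (\<lambda>x. f x * g x) \<in> Cinf_span n"

lemma Cinf_span_deriv:
  assumes "f \<in> Cinf_span n" "i < n"
  shows "\<exists>g\<in>Cinf_span n. \<forall>x s. ((\<lambda>t. f (x(i := t))) has_field_derivative g (x(i := s))) (at s)"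
  using assms(1)
proof induction
  case (base f)
  then show ?case
    using Cinf_has_partial_deriv Cinf_partial_deriv assms(2) Cinf_span.base by blast
next
  case (add f g)
  then obtain f' g' where "f' \<in> Cinf_span n" "g' \<in> Cinf_span n"
    "\<And>x s. ((\<lambda>t. f (x(i := t))) has_field_derivative f' (x(i := s))) (at s)"
    "\<And>x s. ((\<lambda>t. g (x(i := t))) has_field_derivative g' (x(i := s))) (at s)" by blast
  then show ?case
    by (intro bexI[of _ "\<lambda>x. f' x + g' x"] allI DERIV_add Cinf_span.add)
next
  case (mult f g)
  then obtain f' g' where "f' \<in> Cinf_span n" "g' \<in> Cinf_span n"
    "\<And>x s. ((\<lambda>t. f (x(i := t))) has_field_derivative f' (x(i := s))) (at s)"
    "\<And>x s. ((\<lambda>t. g (x(i := t))) has_field_derivative g' (x(i := s))) (at s)" by blast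
  with mult.hyps show ?case
    by (intro bexI[of _ "\<lambda>x. f' x * g x + g' x * f x"] allI DERIV_mult Cinf_span.add Cinf_span.mult)
qed

lemma Cinf_span_eq: "Cinf_span n = Cinf n"
proof
  show "Cinf_span n \<subseteq> Cinf n"
  proof
    fix f assume "f \<in> Cinf_span n"
    then show "f \<in> Cinf n"
    proof (rule Cinf_coinduct)
      fix g i x assume g: "g \<in> Cinf_span n"
      then show "depends_on_first n g"
      proof induction
        case (base f) then show ?case by (simp add: Cinf_def)
      qed (unfold depends_on_first_def, metis+)
      show "continuous_on UNIV g"
        using g by induction (auto intro: Cinf_continuous continuous_intros)
      assume i: "i < n"
      obtain g' where g': "g' \<in> Cinf_span n"
        "\<And>x s. ((\<lambda>t. g (x(i := t))) has_field_derivative g' (x(i := s))) (at s)"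
        using Cinf_span_deriv[OF g i] by blast
      then show "\<exists>D. ((\<lambda>t. g (x(i := t))) has_field_derivative D) (at (x i))" by blast
      have "partial_deriv i g = g'"
        using g'(2) by (intro partial_deriv_eqI) (metis fun_upd_triv)
      with g'(1) show "partial_deriv i g \<in> Cinf_span n" by simp
    qed
  qed
qed (auto intro: Cinf_span.base)

lemma Cinf_add: "f \<in> Cinf n \<Longrightarrow> g \<in> Cinf n \<Longrightarrow> (\<lambda>x. f x + g x) \<in> Cinf n"
  using Cinf_span.add[of f n g] by (simp add: Cinf_span_eq)

lemma Cinf_mult: "f \<in> Cinf n \<Longrightarrow> g \<in> Cinf n \<Longrightarrow> (\<lambda>x. f x * g x) \<in> Cinf n"
  using Cinf_span.mult[of f n g] by (simp add: Cinf_span_eq)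

lemmas Cinf_intros = Cinf_const Cinf_coord Cinf_add Cinf_mult

section \<open>Hadamard's lemma in one direction\<close>

text \<open>
  For \<open>i < n\<close> and \<open>f\<close> depending on \<open>x 0, \<dots>, x (n - 1)\<close>, the coordinate \<open>x n\<close> serves as the length of a
  segment from \<open>x\<close> in direction \<open>i\<close>.  The case \<open>j = 0\<close> is the average of \<open>f\<close> over this segment; the
  weight \<open>t ^ j\<close> makes the class closed under differentiation, because each derivative in direction
  \<open>n\<close> produces a factor \<open>t\<close>.
\<close>
definition segment_moment ::
    "nat \<Rightarrow> nat \<Rightarrow> nat \<Rightarrow> ((nat \<Rightarrow> real) \<Rightarrow> real) \<Rightarrow> (nat \<Rightarrow> real) \<Rightarrow> real" where
  "segment_moment n i j f x = integral {0..1} (\<lambda>t. t ^ j * f (x(i := x i + t * x n)))"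

lemma continuous_on_segment:
  assumes "f \<in> Cinf m" "continuous_on S p" "continuous_on S q" "continuous_on S r"
  shows "continuous_on S (\<lambda>z. (r z :: real) ^ j * f ((p z)(i := q z)))"
proof -
  have "continuous_on S (\<lambda>z. (p z)(i := q z))"
  proof (rule continuous_on_coordinatewise_then_product)
    fix k show "continuous_on S (\<lambda>z. ((p z)(i := q z)) k)"
      using assms(3) continuous_on_product_then_coordinatewise[OF assms(2), of k]
      by (cases "k = i") auto
  qed
  then show ?thesis
    using continuous_on_compose2[OF Cinf_continuous[OF assms(1)]] assms(4)
    by (auto intro!: continuous_intros)
qed

lemma segment_moment_continuous:
  assumes "f \<in> Cinf n"
  shows "continuous_on UNIV (segment_moment n i j f)"
proof -
  have coord: "continuous_on UNIV (\<lambda>z::(nat \<Rightarrow> real) \<times> real. fst z k)" for k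
    by (rule continuous_on_product_then_coordinatewise) (intro continuous_intros)
  have "continuous_on (UNIV \<times> cbox 0 1)
      (\<lambda>(x::nat \<Rightarrow> real, t). t ^ j * f (x(i := x i + t * x n)))"
    unfolding split_beta
    by (rule continuous_on_subset[OF continuous_on_segment[OF assms], of UNIV])
      (auto intro!: continuous_on_add continuous_on_mult continuous_on_fst continuous_on_snd
         continuous_on_id coord)
  from integral_continuous_on_param[OF this] show ?thesis
    by (simp add: segment_moment_def[abs_def])
qed

text \<open>Differentiation under the integral sign along a line in direction \<open>k\<close>.  The points of the segment
  are left unsimplified, so that the cases \<open>k = i\<close>, \<open>k = n\<close> and all other \<open>k\<close> share one proof.\<close>
lemma segment_moment_deriv_aux:
  assumes f: "f \<in> Cinf n" and g: "g \<in> Cinf n"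
    and deriv: "\<And>s t. ((\<lambda>s. t ^ j * f ((x(k := s))(i := (x(k := s)) i + t * (x(k := s)) n)))
      has_field_derivative t ^ l * g ((x(k := s))(i := (x(k := s)) i + t * (x(k := s)) n))) (at s)"
  shows "((\<lambda>s. segment_moment n i j f (x(k := s)))
      has_field_derivative segment_moment n i l g (x(k := s))) (at s)"
proof -
  have cont: "continuous_on S (\<lambda>z. r z ^ m * h ((x(k := p z))(i := (x(k := p z)) i + r z * (x(k := p z)) n)))"
    if h: "h \<in> Cinf n" and p: "continuous_on S p" and r: "continuous_on S r"
    for h m and S :: "'c::topological_space set" and p r :: "'c \<Rightarrow> real"
  proof -
    have c: "continuous_on S (\<lambda>z. (x(k := p z)) a)" for a
      using p by (cases "a = k") auto
    show ?thesis
      by (intro continuous_on_segment[OF h] continuous_on_coordinatewise_then_product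
          continuous_on_add continuous_on_mult c r)
  qed
  have "((\<lambda>s. integral (cbox 0 1) (\<lambda>t. t ^ j * f ((x(k := s))(i := (x(k := s)) i + t * (x(k := s)) n))))
     has_field_derivative integral (cbox 0 1)
       (\<lambda>t. t ^ l * g ((x(k := s))(i := (x(k := s)) i + t * (x(k := s)) n)))) (at s within UNIV)"
  proof (rule leibniz_rule_field_derivative)
    show "(\<lambda>t. t ^ j * f ((x(k := s))(i := (x(k := s)) i + t * (x(k := s)) n))) integrable_on cbox 0 1" for s
      by (intro integrable_continuous cont f continuous_on_const continuous_on_id)
    show "continuous_on (UNIV \<times> cbox 0 1)
      (\<lambda>(s, t). t ^ l * g ((x(k := s))(i := (x(k := s)) i + t * (x(k := s)) n)))"
      unfolding split_beta
      by (intro cont g continuous_on_fst continuous_on_snd continuous_on_id)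
  qed (simp_all only: UNIV_I convex_UNIV deriv)
  then show ?thesis
    by (simp only: segment_moment_def[abs_def] cbox_interval)
qed

text \<open>The derivatives of a moment are again moments: in direction \<open>n\<close> of \<open>\<partial>\<^sub>i f\<close> with exponent \<open>j + 1\<close>, in
  every other direction \<open>k\<close> of \<open>\<partial>\<^sub>k f\<close> with the same exponent.\<close>
lemma segment_moment_deriv:
  assumes f: "f \<in> Cinf n" and "i < n" "k < Suc n"
  shows "\<exists>l. \<exists>g\<in>Cinf n. \<forall>x s. ((\<lambda>s. segment_moment n i j f (x(k := s)))
      has_field_derivative segment_moment n i l g (x(k := s))) (at s)"
proof (cases "k = n")
  case True
  let ?g = "partial_deriv i f"
  have g: "?g \<in> Cinf n" using f assms(2) by (rule Cinf_partial_deriv)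
  have "((\<lambda>s. t ^ j * f ((x(k := s))(i := (x(k := s)) i + t * (x(k := s)) n)))
      has_field_derivative t ^ Suc j * ?g ((x(k := s))(i := (x(k := s)) i + t * (x(k := s)) n))) (at s)"
    for x s t
  proof -
    have eq: "h ((x(k := s))(i := (x(k := s)) i + t * (x(k := s)) n)) = h (x(i := x i + t * s))"
      if "h \<in> Cinf n" for h s
      by (rule Cinf_depends[OF that]) (use True assms(2) in auto)
    have "((\<lambda>s. f (x(i := x i + t * s))) has_field_derivative ?g (x(i := x i + t * s)) * t) (at s)"
      by (rule DERIV_chain2[OF Cinf_has_partial_deriv[OF f assms(2)]]) (auto intro!: derivative_eq_intros)
    then show ?thesis
      unfolding eq[OF f] eq[OF g] by (auto intro!: derivative_eq_intros)
  qed
  from segment_moment_deriv_aux[OF f g this] show ?thesis using g by blast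
next
  case False
  then have k: "k < n" using assms(3) by simp
  let ?g = "partial_deriv k f"
  have g: "?g \<in> Cinf n" using f k by (rule Cinf_partial_deriv)
  have "((\<lambda>s. t ^ j * f ((x(k := s))(i := (x(k := s)) i + t * (x(k := s)) n)))
      has_field_derivative t ^ j * ?g ((x(k := s))(i := (x(k := s)) i + t * (x(k := s)) n))) (at s)"
    for x s t
  proof (cases "k = i")
    case True
    have "((\<lambda>s. f (x(i := s + t * x n))) has_field_derivative ?g (x(i := s + t * x n)) * 1) (at s)"
      unfolding True
      by (rule DERIV_chain2[OF Cinf_has_partial_deriv[OF f assms(2)]]) (auto intro!: derivative_eq_intros)
    with True False show ?thesis
      by (auto intro!: derivative_eq_intros)
  next
    case ki: False
    have "((\<lambda>s. f ((x(i := x i + t * x n))(k := s))) has_field_derivative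
       ?g ((x(i := x i + t * x n))(k := s))) (at s)"
      by (rule Cinf_has_partial_deriv[OF f k])
    with ki False show ?thesis
      by (auto intro!: derivative_eq_intros simp: fun_upd_twist[OF ki])
  qed
  from segment_moment_deriv_aux[OF f g this] show ?thesis using g by blast
qed

lemma Cinf_segment_moment:
  assumes "f \<in> Cinf n" "i < n"
  shows "segment_moment n i j f \<in> Cinf (Suc n)"
proof (rule Cinf_coinduct[where F="{segment_moment n i j f | j f. f \<in> Cinf n}"])
  fix g k x assume "g \<in> {segment_moment n i j f | j f. f \<in> Cinf n}"
  then obtain j f where g: "g = segment_moment n i j f" and f: "f \<in> Cinf n" by blast
  show "depends_on_first (Suc n) g"
    unfolding depends_on_first_def
  proof (intro allI impI)
    fix x y :: "nat \<Rightarrow> real" assume eq: "\<forall>k<Suc n. x k = y k"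
    have "f (x(i := x i + t * x n)) = f (y(i := y i + t * y n))" for t
      by (rule Cinf_depends[OF f]) (use eq assms(2) in auto)
    then show "g x = g y"
      by (simp only: g segment_moment_def)
  qed
  show "continuous_on UNIV g"
    unfolding g by (rule segment_moment_continuous[OF f])
  assume k: "k < Suc n"
  obtain l f' where f': "f' \<in> Cinf n" and
    deriv: "\<And>x s. ((\<lambda>s. g (x(k := s))) has_field_derivative segment_moment n i l f' (x(k := s))) (at s)"
    using segment_moment_deriv[OF f assms(2) k] unfolding g by blast
  then show "\<exists>D. ((\<lambda>t. g (x(k := t))) has_field_derivative D) (at (x k))" by blast
  have "partial_deriv k g = segment_moment n i l f'"
    using deriv by (intro partial_deriv_eqI) (metis fun_upd_triv)
  with f' show "partial_deriv k g \<in> {segment_moment n i j f | j f. f \<in> Cinf n}" by blast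
qed (use assms in auto)

text \<open>
  The quotient of \<open>f (x + y e\<^sub>i) - f x\<close> by \<open>y\<close> is the average of \<open>\<partial>\<^sub>i f\<close> over the segment, by the
  fundamental theorem of calculus, and is therefore smooth; here \<open>y\<close> is the extra coordinate \<open>x n\<close>.
\<close>
lemma Hadamard:
  assumes f: "f \<in> Cinf n" and i: "i < n"
  obtains g where "g \<in> Cinf (Suc n)" "\<And>x. f (x(i := x i + x n)) = f x + x n * g x"
proof
  show "segment_moment n i 0 (partial_deriv i f) \<in> Cinf (Suc n)"
    using Cinf_segment_moment[OF Cinf_partial_deriv[OF f i] i] .
  fix x :: "nat \<Rightarrow> real"
  let ?f' = "\<lambda>t. partial_deriv i f (x(i := x i + t * x n))"
  have "((\<lambda>t. f (x(i := x i + t * x n))) has_field_derivative ?f' t * x n) (at t within {0..1})" for t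
    by (rule DERIV_subset[OF DERIV_chain2[OF Cinf_has_partial_deriv[OF f i]]])
      (auto intro!: derivative_eq_intros)
  then have "((\<lambda>t. ?f' t * x n) has_integral f (x(i := x i + 1 * x n)) - f (x(i := x i + 0 * x n))) {0..1}"
    unfolding has_real_derivative_iff_has_vector_derivative
    by (intro fundamental_theorem_of_calculus zero_le_one)
  then have "integral {0..1} (\<lambda>t. ?f' t * x n) = f (x(i := x i + x n)) - f x"
    by (intro integral_unique) simp
  then show "f (x(i := x i + x n)) = f x + x n * segment_moment n i 0 (partial_deriv i f) x"
    by (simp add: segment_moment_def mult.commute)
qed

section \<open>The commutative algebra underlying a \<open>C\<^sup>\<infinity>\<close>-ring\<close>

lemma carrier_cinf_alg [simp]: "carrier (cinf_alg A) = carrier A"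
  by (simp add: cinf_alg_def)

lemma cinf_alg_ops:
  "a \<otimes>\<^bsub>cinf_alg A\<^esub> b = cop A (\<lambda>x. x 0 * x 1) [a, b]"
  "\<one>\<^bsub>cinf_alg A\<^esub> = cop A (\<lambda>_. 1) []"
  "\<zero>\<^bsub>cinf_alg A\<^esub> = cop A (\<lambda>_. 0) []"
  "a \<oplus>\<^bsub>cinf_alg A\<^esub> b = cop A (\<lambda>x. x 0 + x 1) [a, b]"
  "r \<odot>\<^bsub>cinf_alg A\<^esub> a = cop A (\<lambda>x. r * x 0) [a]"
  by (simp_all add: cinf_alg_def)

context cinf_ring
begin

abbreviation "R \<equiv> cinf_alg A"

lemma cop_comp_eq:
  assumes "f \<in> Cinf (length gs)" "set gs \<subseteq> Cinf (length as)" "set as \<subseteq> carrier A"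
    and "bs = map (\<lambda>g. cop A g as) gs" "\<And>x. f (\<lambda>i. (gs ! i) x) = h x"
  shows "cop A f bs = cop A h as"
  using cop_comp[OF assms(1-3)] assms(4,5) by simp

lemma cop_add:
  assumes "set as \<subseteq> carrier A" "f \<in> Cinf (length as)" "g \<in> Cinf (length as)"
  shows "cop A f as \<oplus>\<^bsub>R\<^esub> cop A g as = cop A (\<lambda>x. f x + g x) as"
  unfolding cinf_alg_ops
  by (rule cop_comp_eq[where gs="[f, g]"]) (use assms in \<open>auto intro: Cinf_intros\<close>)

lemma cop_mult:
  assumes "set as \<subseteq> carrier A" "f \<in> Cinf (length as)" "g \<in> Cinf (length as)"
  shows "cop A f as \<otimes>\<^bsub>R\<^esub> cop A g as = cop A (\<lambda>x. f x * g x) as"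
  unfolding cinf_alg_ops
  by (rule cop_comp_eq[where gs="[f, g]"]) (use assms in \<open>auto intro: Cinf_intros\<close>)

lemma cop_smult:
  assumes "set as \<subseteq> carrier A" "f \<in> Cinf (length as)"
  shows "r \<odot>\<^bsub>R\<^esub> cop A f as = cop A (\<lambda>x. r * f x) as"
  unfolding cinf_alg_ops
  by (rule cop_comp_eq[where gs="[f]"]) (use assms in \<open>auto intro: Cinf_intros\<close>)

lemma cop_const:
  assumes "set as \<subseteq> carrier A"
  shows "cop A (\<lambda>_. c) [] = cop A (\<lambda>_. c) as"
  by (rule cop_comp_eq[where gs="[]"]) (use assms in \<open>auto intro: Cinf_intros\<close>)

text \<open>
  Any three elements are values of coordinate functions at one argument list.  An identity of the
  algebra thereby reduces, by compatibility with composition, to the same identity between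
  real-valued functions.
\<close>
lemma common_arguments:
  assumes "a \<in> carrier A" "b \<in> carrier A" "c \<in> carrier A"
  obtains as f g h where "set as \<subseteq> carrier A"
    "f \<in> Cinf (length as)" "g \<in> Cinf (length as)" "h \<in> Cinf (length as)"
    "a = cop A f as" "b = cop A g as" "c = cop A h as"
proof
  show "set [a, b, c] \<subseteq> carrier A" using assms by simp
  note coord = cop_coord[OF this]
  show "a = cop A (\<lambda>x. x 0) [a, b, c]" "b = cop A (\<lambda>x. x 1) [a, b, c]" "c = cop A (\<lambda>x. x 2) [a, b, c]"
    by (simp_all add: coord)
qed (auto intro: Cinf_coord)

lemma cop_zero: "set as \<subseteq> carrier A \<Longrightarrow> \<zero>\<^bsub>R\<^esub> = cop A (\<lambda>_. 0) as"
  and cop_one: "set as \<subseteq> carrier A \<Longrightarrow> \<one>\<^bsub>R\<^esub> = cop A (\<lambda>_. 1) as"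
  unfolding cinf_alg_ops by (rule cop_const; assumption)+

lemmas cop_ops = cop_add cop_mult cop_smult cop_zero cop_one

lemma cring_cinf_alg: "cring R"
proof (intro cringI abelian_groupI comm_monoidI; (unfold carrier_cinf_alg)?)
  fix a b c assume "a \<in> carrier A" "b \<in> carrier A" "c \<in> carrier A"
  then obtain as f g h where *: "set as \<subseteq> carrier A"
    "f \<in> Cinf (length as)" "g \<in> Cinf (length as)" "h \<in> Cinf (length as)"
    "a = cop A f as" "b = cop A g as" "c = cop A h as" by (rule common_arguments)
  show "a \<oplus>\<^bsub>R\<^esub> b \<oplus>\<^bsub>R\<^esub> c = a \<oplus>\<^bsub>R\<^esub> (b \<oplus>\<^bsub>R\<^esub> c)"
    "a \<otimes>\<^bsub>R\<^esub> b \<otimes>\<^bsub>R\<^esub> c = a \<otimes>\<^bsub>R\<^esub> (b \<otimes>\<^bsub>R\<^esub> c)"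
    "(a \<oplus>\<^bsub>R\<^esub> b) \<otimes>\<^bsub>R\<^esub> c = a \<otimes>\<^bsub>R\<^esub> c \<oplus>\<^bsub>R\<^esub> b \<otimes>\<^bsub>R\<^esub> c"
    using * by (simp_all add: cop_ops Cinf_intros algebra_simps)
next
  fix a b assume "a \<in> carrier A" "b \<in> carrier A"
  from common_arguments[OF this this(2)] obtain as f g where *: "set as \<subseteq> carrier A"
    "f \<in> Cinf (length as)" "g \<in> Cinf (length as)" "a = cop A f as" "b = cop A g as" by metis
  show "a \<oplus>\<^bsub>R\<^esub> b = b \<oplus>\<^bsub>R\<^esub> a" "a \<otimes>\<^bsub>R\<^esub> b = b \<otimes>\<^bsub>R\<^esub> a"
    "a \<oplus>\<^bsub>R\<^esub> b \<in> carrier A" "a \<otimes>\<^bsub>R\<^esub> b \<in> carrier A"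
    using * by (simp_all add: cop_ops Cinf_intros cop_closed algebra_simps)
next
  fix a assume "a \<in> carrier A"
  from common_arguments[OF this this this] obtain as f where *: "set as \<subseteq> carrier A"
    "f \<in> Cinf (length as)" "a = cop A f as" by metis
  show "\<zero>\<^bsub>R\<^esub> \<oplus>\<^bsub>R\<^esub> a = a" "\<one>\<^bsub>R\<^esub> \<otimes>\<^bsub>R\<^esub> a = a"
    using * by (simp_all add: cop_ops(1,2) cop_ops(4,5)[OF *(1)] Cinf_intros)
  have "cop A (\<lambda>x. -1 * f x) as \<oplus>\<^bsub>R\<^esub> a = \<zero>\<^bsub>R\<^esub>"
    using * by (simp add: cop_add cop_zero[OF *(1)] Cinf_intros Cinf_mult[OF Cinf_const, of _ _ "-1", simplified])
  moreover have "cop A (\<lambda>x. -1 * f x) as \<in> carrier A"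
    using * by (intro cop_closed Cinf_intros)
  ultimately show "\<exists>b\<in>carrier A. b \<oplus>\<^bsub>R\<^esub> a = \<zero>\<^bsub>R\<^esub>" by blast
qed (simp_all add: cinf_alg_ops cop_closed Cinf_intros)

sublocale alg: cring "cinf_alg A"
  by (rule cring_cinf_alg)

lemma cop_drop_last:
  assumes "f \<in> Cinf (length as)" "set as \<subseteq> carrier A" "c \<in> carrier A"
  shows "cop A f as = cop A f (as @ [c])"
proof (rule cop_comp_eq[where gs="map (\<lambda>k x. x k) [0..<length as]"])
  show "as = map (\<lambda>g. cop A g (as @ [c])) (map (\<lambda>k x. x k) [0..<length as])"
    using assms by (intro nth_equalityI) (auto simp: cop_coord nth_append)
qed (use assms in \<open>auto intro: Cinf_coord intro!: Cinf_depends[OF assms(1)]\<close>)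

text \<open>
  Hadamard's lemma inside a \<open>C\<^sup>\<infinity>\<close>-ring: a perturbation of one argument by \<open>c\<close> changes the value by a
  multiple of \<open>c\<close>.  This is why every ideal of the algebra is a congruence for all smooth operations.
\<close>
lemma cop_perturb:
  assumes f: "f \<in> Cinf (length as)" and as: "set as \<subseteq> carrier A"
    and c: "c \<in> carrier A" and i: "i < length as"
  shows "\<exists>d\<in>carrier A. cop A f (as[i := as ! i \<oplus>\<^bsub>R\<^esub> c]) = cop A f as \<oplus>\<^bsub>R\<^esub> c \<otimes>\<^bsub>R\<^esub> d"
proof -
  define n where "n = length as"
  define bs where "bs = as @ [c]"
  have bs: "set bs \<subseteq> carrier A" "length bs = Suc n" using as c by (auto simp: bs_def n_def)
  have coord: "cop A (\<lambda>x. x k) bs = (if k < n then as ! k else c)" if "k < Suc n" for k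
    using that bs by (auto simp: cop_coord bs_def nth_append n_def less_Suc_eq)
  obtain g where g: "g \<in> Cinf (Suc n)" "\<And>x. f (x(i := x i + x n)) = f x + x n * g x"
    using Hadamard[OF f i] unfolding n_def by blast
  have f': "f \<in> Cinf (Suc n)" using f unfolding n_def by (rule Cinf_mono) simp
  define gs where "gs = map (\<lambda>k x. if k = i then x i + x n else (x k :: real)) [0..<n]"
  have gs: "set gs \<subseteq> Cinf (length bs)"
  proof
    fix h assume "h \<in> set gs"
    then obtain k where k: "k < n" "h = (\<lambda>x. if k = i then x i + x n else x k)"
      by (auto simp: gs_def)
    then show "h \<in> Cinf (length bs)"
      by (cases "k = i") (auto simp: bs intro!: Cinf_intros)
  qed
  have "cop A f (as[i := as ! i \<oplus>\<^bsub>R\<^esub> c]) = cop A (\<lambda>x. f x + x n * g x) bs"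
  proof (rule cop_comp_eq[OF _ gs bs(1)])
    show "as[i := as ! i \<oplus>\<^bsub>R\<^esub> c] = map (\<lambda>g. cop A g bs) gs"
    proof (rule nth_equalityI)
      fix k assume "k < length (as[i := as ! i \<oplus>\<^bsub>R\<^esub> c])"
      then have k: "k < n" by (simp add: n_def)
      have "as ! i \<oplus>\<^bsub>R\<^esub> c = cop A (\<lambda>x. x i + x n) bs"
        using cop_add[OF bs(1), of "\<lambda>x. x i" "\<lambda>x. x n"] i coord[of i] coord[of n]
        by (simp add: n_def bs Cinf_coord)
      then show "as[i := as ! i \<oplus>\<^bsub>R\<^esub> c] ! k = map (\<lambda>g. cop A g bs) gs ! k"
        using k i coord[of k] by (cases "k = i") (simp_all add: gs_def n_def)
    qed (simp add: gs_def n_def)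
    show "f (\<lambda>k. (gs ! k) x) = f x + x n * g x" for x
      unfolding g(2)[symmetric]
      by (rule Cinf_depends[OF f]) (auto simp: gs_def n_def)
  qed (use f in \<open>simp add: gs_def n_def\<close>)
  also have "\<dots> = cop A f bs \<oplus>\<^bsub>R\<^esub> cop A (\<lambda>x. x n) bs \<otimes>\<^bsub>R\<^esub> cop A g bs"
    using bs f' g(1) by (simp add: cop_add cop_mult Cinf_intros)
  also have "\<dots> = cop A f as \<oplus>\<^bsub>R\<^esub> c \<otimes>\<^bsub>R\<^esub> cop A g bs"
    using cop_drop_last[OF f as c] coord[of n] by (simp add: bs_def)
  finally show ?thesis
    using cop_closed[OF _ bs(1), of g] g(1) bs(2) by auto
qed

end

section \<open>Homomorphisms\<close>

definition cinf_hom :: "('a \<Rightarrow> 'c) \<Rightarrow> ('a, 'b) cinf_struct_scheme \<Rightarrow> ('c, 'd) cinf_struct_scheme \<Rightarrow> bool" where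
  "cinf_hom h A B \<longleftrightarrow> h ` carrier A \<subseteq> carrier B \<and>
     (\<forall>f as. f \<in> Cinf (length as) \<longrightarrow> set as \<subseteq> carrier A \<longrightarrow> h (cop A f as) = cop B f (map h as))"

lemma cinf_hom_cop:
  "cinf_hom h A B \<Longrightarrow> f \<in> Cinf (length as) \<Longrightarrow> set as \<subseteq> carrier A \<Longrightarrow> h (cop A f as) = cop B f (map h as)"
  by (simp add: cinf_hom_def)

lemma cinf_hom_ring_hom:
  assumes "cinf_ring A" "cinf_ring B" "cinf_hom h A B"
  shows "ring_hom_cring (cinf_alg A) (cinf_alg B) h"
proof (intro ring_hom_cring.intro ring_hom_cring_axioms.intro ring_hom_memI)
  show "cring (cinf_alg A)" "cring (cinf_alg B)"
    using assms by (simp_all add: cinf_ring.cring_cinf_alg)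
qed (use assms(3) in \<open>auto simp: cinf_alg_ops cinf_hom_cop[OF assms(3)] Cinf_intros cinf_hom_def\<close>)

lemma cinf_hom_smult:
  assumes "cinf_hom h A B" "a \<in> carrier A"
  shows "h (r \<odot>\<^bsub>cinf_alg A\<^esub> a) = r \<odot>\<^bsub>cinf_alg B\<^esub> h a"
  using assms by (simp add: cinf_alg_ops cinf_hom_cop Cinf_intros)

text \<open>The Poisson axioms are equations between terms in the bracket and the smooth operations, so they pass
  to images under maps that preserve both.\<close>
lemma poisson_cinf_ring_image:
  fixes A :: "('a, 'b) poisson_struct_scheme" and B :: "('c, 'd) poisson_struct_scheme"
  assumes A: "poisson_cinf_ring A" and B: "cinf_ring B"
    and h: "cinf_hom h A B" and surj: "carrier B = h ` carrier A"
    and br: "\<And>a b. a \<in> carrier A \<Longrightarrow> b \<in> carrier A \<Longrightarrow> bracket B (h a) (h b) = h (bracket A a b)"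
  shows "poisson_cinf_ring B"
proof -
  interpret A: poisson_cinf_ring A by (rule A)
  interpret B: cinf_ring B by (rule B)
  interpret h: ring_hom_cring "cinf_alg A" "cinf_alg B" h
    by (rule cinf_hom_ring_hom[OF A.cinf_ring_axioms B h])
  have closed: "bracket A a b \<in> carrier A" if "a \<in> carrier A" "b \<in> carrier A" for a b
    using A.br_closed that by simp
  have smult: "r \<odot>\<^bsub>cinf_alg A\<^esub> a \<in> carrier A" if "a \<in> carrier A" for r a
    using that unfolding cinf_alg_ops by (intro A.cop_closed Cinf_intros) auto
  note hom = h.hom_add[symmetric] h.hom_mult[symmetric] cinf_hom_smult[OF h, symmetric]
    h.hom_zero[symmetric] br closed smult
    A.alg.a_closed[unfolded carrier_cinf_alg] A.alg.m_closed[unfolded carrier_cinf_alg]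
  note [simp del] = h.hom_add h.hom_mult h.hom_zero h.hom_a_inv h.hom_finsum
  show ?thesis
  proof (intro poisson_cinf_ring.intro poisson_bracket.intro poisson_cinf_ring_axioms.intro B, unfold carrier_cinf_alg surj)
    fix a b assume "a \<in> h ` carrier A" "b \<in> h ` carrier A"
    then obtain a' b' where *: "a' \<in> carrier A" "b' \<in> carrier A" "a = h a'" "b = h b'" by blast
    then show "bracket B a b \<in> h ` carrier A"
      by (simp add: hom)
    have "bracket A a' b' = \<ominus>\<^bsub>cinf_alg A\<^esub> bracket A b' a'"
      using * by (intro A.br_skew) simp_all
    with * show "bracket B a b = \<ominus>\<^bsub>cinf_alg B\<^esub> bracket B b a"
      by (simp add: br h.hom_a_inv closed)
    fix r from \<open>a \<in> h ` carrier A\<close> \<open>b \<in> h ` carrier A\<close>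
    show "bracket B (r \<odot>\<^bsub>cinf_alg B\<^esub> a) b = r \<odot>\<^bsub>cinf_alg B\<^esub> bracket B a b"
      "bracket B a (r \<odot>\<^bsub>cinf_alg B\<^esub> b) = r \<odot>\<^bsub>cinf_alg B\<^esub> bracket B a b"
      using A.br_smult_left A.br_smult_right by (auto simp: hom)
  next
    fix a b c assume "a \<in> h ` carrier A" "b \<in> h ` carrier A" "c \<in> h ` carrier A"
    then show "bracket B (a \<oplus>\<^bsub>cinf_alg B\<^esub> b) c = bracket B a c \<oplus>\<^bsub>cinf_alg B\<^esub> bracket B b c"
      "bracket B a (b \<oplus>\<^bsub>cinf_alg B\<^esub> c) = bracket B a b \<oplus>\<^bsub>cinf_alg B\<^esub> bracket B a c"
      "bracket B a (b \<otimes>\<^bsub>cinf_alg B\<^esub> c) =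
         bracket B a b \<otimes>\<^bsub>cinf_alg B\<^esub> c \<oplus>\<^bsub>cinf_alg B\<^esub> b \<otimes>\<^bsub>cinf_alg B\<^esub> bracket B a c"
      "bracket B a (bracket B b c) \<oplus>\<^bsub>cinf_alg B\<^esub> bracket B b (bracket B c a)
         \<oplus>\<^bsub>cinf_alg B\<^esub> bracket B c (bracket B a b) = \<zero>\<^bsub>cinf_alg B\<^esub>"
      using A.br_add_left A.br_add_right A.br_leibniz A.br_jacobi by (auto simp: hom)
  next
    fix a as f assume a: "a \<in> h ` carrier A" and "as \<noteq> []" "set as \<subseteq> h ` carrier A"
      and f: "f \<in> Cinf (length as)"
    then obtain a' where a': "a' \<in> carrier A" "a = h a'" by blast
    have "as \<in> map h ` lists (carrier A)"
      using \<open>set as \<subseteq> h ` carrier A\<close> by (simp add: lists_image[symmetric] in_lists_conv_set subset_iff)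
    then obtain as' where as': "set as' \<subseteq> carrier A" "as = map h as'" by auto
    let ?n = "length as'"
    have f': "f \<in> Cinf ?n" using f as' by simp
    have p: "partial_deriv i f \<in> Cinf ?n" if "i < ?n" for i
      using f' that by (rule Cinf_partial_deriv)
    let ?t = "\<lambda>i. cop A (partial_deriv i f) as' \<otimes>\<^bsub>cinf_alg A\<^esub> bracket A a' (as' ! i)"
    have nth: "as' ! i \<in> carrier A" if "i < ?n" for i
      using as'(1) that by (meson nth_mem subset_iff)
    have t: "?t \<in> {..<?n} \<rightarrow> carrier (cinf_alg A)"
      using p as'(1) a' nth by (auto simp: closed A.cop_closed intro!: A.alg.m_closed[unfolded carrier_cinf_alg])
    have "bracket B a (cop B f as) = h (bracket A a' (cop A f as'))"
      using a' as' f' by (simp add: cinf_hom_cop[OF h, symmetric] br A.cop_closed)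
    also have "\<dots> = h (\<Oplus>\<^bsub>cinf_alg A\<^esub>i\<in>{..<?n}. ?t i)"
      using A.bracket_cop[OF a'(1) _ as'(1) f'] \<open>as \<noteq> []\<close> as'(2) by simp
    also have "\<dots> = (\<Oplus>\<^bsub>cinf_alg B\<^esub>i\<in>{..<?n}. (h \<circ> ?t) i)"
      using t by (rule h.hom_finsum)
    also have "\<dots> = (\<Oplus>\<^bsub>cinf_alg B\<^esub>i\<in>{..<length as}.
        cop B (partial_deriv i f) as \<otimes>\<^bsub>cinf_alg B\<^esub> bracket B a (as ! i))"
    proof -
      have eq: "cop B (partial_deriv i f) as \<otimes>\<^bsub>cinf_alg B\<^esub> bracket B a (as ! i) = (h \<circ> ?t) i"
        if i: "i < ?n" for i
        using i as' a' nth[OF i] p[OF i]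
        by (simp add: h.hom_mult closed A.cop_closed br cinf_hom_cop[OF h])
      show ?thesis
        using as' eq Pi_mem[OF t] by (intro B.alg.finsum_cong') (auto simp del: carrier_cinf_alg)
    qed
    finally show "bracket B a (cop B f as) = (\<Oplus>\<^bsub>cinf_alg B\<^esub>i\<in>{..<length as}.
        cop B (partial_deriv i f) as \<otimes>\<^bsub>cinf_alg B\<^esub> bracket B a (as ! i))" .
  qed
qed

section \<open>Subrings closed under the bracket\<close>

lemma cinf_ring_subring:
  fixes A :: "('a, 'b) cinf_struct_scheme"
  assumes "cinf_ring A" "cinf_subring S A"
  shows "cinf_ring (A\<lparr>carrier := S\<rparr>)"
proof -
  interpret cinf_ring A by fact
  have S: "S \<subseteq> carrier A" using assms(2) by (simp add: cinf_subring_def)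
  show ?thesis
  proof
    fix f and gs :: "((nat \<Rightarrow> real) \<Rightarrow> real) list" and as
    assume "f \<in> Cinf (length gs)" "set gs \<subseteq> Cinf (length as)"
      "set as \<subseteq> carrier (A\<lparr>carrier := S\<rparr>)"
    with S cop_comp[of f gs as]
    show "cop (A\<lparr>carrier := S\<rparr>) f (map (\<lambda>g. cop (A\<lparr>carrier := S\<rparr>) g as) gs)
        = cop (A\<lparr>carrier := S\<rparr>) (\<lambda>x. f (\<lambda>i. (gs ! i) x)) as" by auto
  qed (use S assms(2) in \<open>auto simp: cinf_subring_def cop_coord\<close>)
qed

text \<open>The axioms are inherited.  Negatives and finite sums are formed relative to a carrier; the inclusion,
  being a ring homomorphism, identifies those of the subring with those of the ambient ring.\<close>
lemma poisson_subring:
  fixes A :: "('a, 'b) poisson_struct_scheme"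
  assumes A: "poisson_cinf_ring A" and S: "cinf_subring S A"
    and br: "\<And>a b. a \<in> S \<Longrightarrow> b \<in> S \<Longrightarrow> bracket A a b \<in> S"
  shows "poisson_cinf_ring (A\<lparr>carrier := S\<rparr>)"
proof -
  let ?B = "A\<lparr>carrier := S\<rparr>"
  interpret A: poisson_cinf_ring A by (rule A)
  have B: "cinf_ring ?B" by (rule cinf_ring_subring[OF A.cinf_ring_axioms S])
  interpret B: cinf_ring ?B by (rule B)
  have SA: "S \<subseteq> carrier A" using S by (simp add: cinf_subring_def)
  interpret h: ring_hom_cring "cinf_alg ?B" "cinf_alg A" "\<lambda>a. a"
    using SA by (intro cinf_hom_ring_hom A.cinf_ring_axioms B) (simp add: cinf_hom_def)
  have ops: "a \<oplus>\<^bsub>cinf_alg ?B\<^esub> b = a \<oplus>\<^bsub>cinf_alg A\<^esub> b" "a \<otimes>\<^bsub>cinf_alg ?B\<^esub> b = a \<otimes>\<^bsub>cinf_alg A\<^esub> b"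
    "r \<odot>\<^bsub>cinf_alg ?B\<^esub> a = r \<odot>\<^bsub>cinf_alg A\<^esub> a" "\<zero>\<^bsub>cinf_alg ?B\<^esub> = \<zero>\<^bsub>cinf_alg A\<^esub>"
    "\<one>\<^bsub>cinf_alg ?B\<^esub> = \<one>\<^bsub>cinf_alg A\<^esub>" for a b r
    by (simp_all add: cinf_alg_ops)
  have inS: "a \<in> S \<Longrightarrow> a \<in> carrier A" for a using SA by blast
  have carr: "carrier ?B = S" "carrier (cinf_alg ?B) = S" "bracket ?B = bracket A" "cop ?B = cop A"
    by simp_all
  show ?thesis
  proof (intro poisson_cinf_ring.intro poisson_bracket.intro poisson_cinf_ring_axioms.intro B,
      unfold carr ops)
    fix a b assume ab: "a \<in> S" "b \<in> S"
    then show "bracket A a b \<in> S" by (rule br)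
    have "bracket A a b = \<ominus>\<^bsub>cinf_alg A\<^esub> bracket A b a"
      using ab by (intro A.br_skew) (simp_all add: inS)
    also have "\<dots> = \<ominus>\<^bsub>cinf_alg ?B\<^esub> bracket A b a"
      using ab by (intro h.hom_a_inv[symmetric]) (simp add: br)
    finally show "bracket A a b = \<ominus>\<^bsub>cinf_alg ?B\<^esub> bracket A b a" .
    show "bracket A (r \<odot>\<^bsub>cinf_alg A\<^esub> a) b = r \<odot>\<^bsub>cinf_alg A\<^esub> bracket A a b"
      "bracket A a (r \<odot>\<^bsub>cinf_alg A\<^esub> b) = r \<odot>\<^bsub>cinf_alg A\<^esub> bracket A a b" for r
      using ab by (simp_all add: inS A.br_smult_left A.br_smult_right)
  next
    fix a b c assume "a \<in> S" "b \<in> S" "c \<in> S"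
    then show "bracket A (a \<oplus>\<^bsub>cinf_alg A\<^esub> b) c = bracket A a c \<oplus>\<^bsub>cinf_alg A\<^esub> bracket A b c"
      "bracket A a (b \<oplus>\<^bsub>cinf_alg A\<^esub> c) = bracket A a b \<oplus>\<^bsub>cinf_alg A\<^esub> bracket A a c"
      "bracket A a (b \<otimes>\<^bsub>cinf_alg A\<^esub> c) =
         bracket A a b \<otimes>\<^bsub>cinf_alg A\<^esub> c \<oplus>\<^bsub>cinf_alg A\<^esub> b \<otimes>\<^bsub>cinf_alg A\<^esub> bracket A a c"
      "bracket A a (bracket A b c) \<oplus>\<^bsub>cinf_alg A\<^esub> bracket A b (bracket A c a)
         \<oplus>\<^bsub>cinf_alg A\<^esub> bracket A c (bracket A a b) = \<zero>\<^bsub>cinf_alg A\<^esub>"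
      by (simp_all add: inS A.br_add_left A.br_add_right A.br_leibniz A.br_jacobi)
  next
    fix a as f assume a: "a \<in> S" and "as \<noteq> []" and as: "set as \<subseteq> S" and f: "f \<in> Cinf (length as)"
    let ?t = "\<lambda>i. cop A (partial_deriv i f) as \<otimes>\<^bsub>cinf_alg A\<^esub> bracket A a (as ! i)"
    have t: "?t \<in> {..<length as} \<rightarrow> carrier (cinf_alg ?B)"
    proof
      fix i assume i: "i \<in> {..<length as}"
      then have "cop A (partial_deriv i f) as \<in> S"
        using B.cop_closed[OF Cinf_partial_deriv[OF f]] as by simp
      moreover have "bracket A a (as ! i) \<in> S"
        using a i as by (intro br) auto
      ultimately show "?t i \<in> carrier (cinf_alg ?B)"
        using B.alg.m_closed unfolding carr ops by blast
    qed
    have "bracket A a (cop A f as) = finsum (cinf_alg A) ?t {..<length as}"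
      using a as f \<open>as \<noteq> []\<close> SA by (intro A.bracket_cop) auto
    also have "\<dots> = finsum (cinf_alg ?B) ?t {..<length as}"
      using h.hom_finsum[OF t] by (simp add: o_def)
    finally show "bracket A a (cop A f as) = finsum (cinf_alg ?B) ?t {..<length as}" .
  qed
qed

section \<open>The normalizer\<close>

context poisson_cinf_ring
begin

text \<open>
  For \<open>s \<in> I\<close> and arguments \<open>a\<^sub>i\<close> in the normalizer, the chain rule writes \<open>{s, f(a\<^sub>1, \<dots>, a\<^sub>n)}\<close> as a
  linear combination of the elements \<open>{s, a\<^sub>i}\<close> of \<open>I\<close>.  The chain rule is only available for \<open>n > 0\<close>;
  a constant operation is therefore read as a unary one, applied to \<open>0\<close>.
\<close>
lemma normalizer_cinf_subring:
  assumes "ideal I R"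
  shows "cinf_subring (normalizer A I) A"
  unfolding cinf_subring_def
proof (intro conjI allI impI)
  interpret I: ideal I R by fact
  have IA: "s \<in> I \<Longrightarrow> s \<in> carrier A" for s using I.a_subset by auto
  show "normalizer A I \<subseteq> carrier A" by (auto simp: normalizer_def)
  have main: "cop A f as \<in> normalizer A I"
    if f: "f \<in> Cinf (length as)" and as: "set as \<subseteq> normalizer A I" and ne: "as \<noteq> []" for f as
  proof -
    have asA: "set as \<subseteq> carrier A" using as by (auto simp: normalizer_def)
    have "bracket A s (cop A f as) \<in> I" if s: "s \<in> I" for s
    proof -
      let ?t = "\<lambda>i. cop A (partial_deriv i f) as \<otimes>\<^bsub>R\<^esub> bracket A s (as ! i)"
      have t: "?t i \<in> I" if "i < length as" for i
      proof (rule I.I_l_closed)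
        have "as ! i \<in> normalizer A I" using as that by auto
        then show "bracket A s (as ! i) \<in> I" using s by (simp add: normalizer_def)
        show "cop A (partial_deriv i f) as \<in> carrier R"
          using cop_closed[OF Cinf_partial_deriv[OF f that] asA] by simp
      qed
      have "finsum R ?t {..<n} \<in> I" if "n \<le> length as" for n
        using that
      proof (induction n)
        case (Suc n)
        moreover have "?t \<in> {..<n} \<rightarrow> carrier R" "?t n \<in> carrier R"
          using Suc.prems t I.a_subset by auto
        ultimately show ?case
          using t by (simp add: lessThan_Suc alg.finsum_insert I.a_closed)
      qed simp
      then show ?thesis
        using bracket_cop[OF IA[OF s] ne asA f] by simp
    qed
    then show ?thesis
      using cop_closed[OF f asA] by (simp add: normalizer_def)
  qed
  fix f as assume f: "f \<in> Cinf (length as)" and as: "set as \<subseteq> normalizer A I"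
  show "cop A f as \<in> normalizer A I"
  proof (cases "as = []")
    case True
    have f_const: "f = (\<lambda>_. f undefined)"
      using f True by (intro ext Cinf_depends[of f 0]) auto
    have zero: "\<zero>\<^bsub>R\<^esub> \<in> carrier A" using alg.zero_closed unfolding carrier_cinf_alg .
    have zeroN: "set [\<zero>\<^bsub>R\<^esub>] \<subseteq> normalizer A I"
    proof -
      have "bracket A s \<zero>\<^bsub>R\<^esub> = \<zero>\<^bsub>R\<^esub>" if "s \<in> I" for s
      proof -
        have "bracket A s \<zero>\<^bsub>R\<^esub> \<oplus>\<^bsub>R\<^esub> bracket A s \<zero>\<^bsub>R\<^esub> = bracket A s \<zero>\<^bsub>R\<^esub>"
          using br_add_right[of s "\<zero>\<^bsub>R\<^esub>" "\<zero>\<^bsub>R\<^esub>", symmetric] IA[OF that] zero by simp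
        moreover have "bracket A s \<zero>\<^bsub>R\<^esub> \<in> carrier R"
          using IA[OF that] by (intro br_closed) (auto simp: zero)
        ultimately show ?thesis using alg.add.r_cancel_one by blast
      qed
      then show ?thesis
        using I.zero_closed zero by (simp add: normalizer_def)
    qed
    have "cop A f as = cop A f [\<zero>\<^bsub>R\<^esub>]"
      using cop_const[of "[\<zero>\<^bsub>R\<^esub>]" "f undefined"] zero True
      by (subst (1 2) f_const) simp
    then show ?thesis
      using main[OF _ zeroN] Cinf_mono[OF f] True by simp
  qed (use main f as in blast)
qed

text \<open>By the Jacobi identity \<open>{s, {a, b}} = - {a, {b, s}} - {b, {s, a}}\<close>, where the inner brackets
  with \<open>s\<close> lie in \<open>I\<close> and hence so do the outer ones.\<close>
lemma normalizer_bracket_closed: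
  assumes "ideal I R" and a: "a \<in> normalizer A I" and b: "b \<in> normalizer A I"
  shows "bracket A a b \<in> normalizer A I"
proof -
  interpret I: ideal I R by fact
  have IA: "s \<in> I \<Longrightarrow> s \<in> carrier R" for s using I.a_subset by auto
  have ab: "a \<in> carrier R" "b \<in> carrier R" using a b by (auto simp: normalizer_def)
  have flip: "bracket A c s \<in> I" if "c \<in> normalizer A I" "s \<in> I" for c s
  proof -
    have "bracket A c s = \<ominus>\<^bsub>R\<^esub> bracket A s c"
      using that IA by (intro br_skew) (auto simp: normalizer_def)
    then show ?thesis using that by (simp add: normalizer_def I.a_inv_closed)
  qed
  have "bracket A s (bracket A a b) \<in> I" if s: "s \<in> I" for s
  proof -
    let ?u = "bracket A s (bracket A a b)"
    let ?v = "bracket A a (bracket A b s)" and ?w = "bracket A b (bracket A s a)"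
    have v: "?v \<in> I" and w: "?w \<in> I"
      using flip a b s by (auto simp: normalizer_def)
    have u: "?u \<in> carrier R" using ab IA[OF s] by (intro br_closed)
    have "?u \<oplus>\<^bsub>R\<^esub> (?v \<oplus>\<^bsub>R\<^esub> ?w) = \<zero>\<^bsub>R\<^esub>"
      using br_jacobi[OF IA[OF s] ab] u v w IA by (simp add: alg.a_assoc)
    then have "?u = \<ominus>\<^bsub>R\<^esub> (?v \<oplus>\<^bsub>R\<^esub> ?w)"
      using u v w IA by (intro alg.minus_equality[symmetric]) auto
    then show ?thesis using v w by (simp add: I.a_inv_closed I.a_closed)
  qed
  then show ?thesis
    using br_closed[OF ab] by (simp add: normalizer_def)
qed

end

section \<open>The quotient by a Poisson ideal\<close>

locale poisson_ideal = poisson_cinf_ring A + ideal J "cinf_alg A"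
  for A :: "('a, 'b) poisson_struct_scheme" (structure) and J +
  assumes bracket_ideal: "j \<in> J \<Longrightarrow> a \<in> carrier A \<Longrightarrow> bracket A j a \<in> J"
begin

abbreviation "coset a \<equiv> J +>\<^bsub>R\<^esub> a"
abbreviation "Q \<equiv> poisson_quot A J"

lemma in_carrier: "j \<in> J \<Longrightarrow> j \<in> carrier A"
  using a_subset by auto

lemma coset_memD:
  assumes "b \<in> coset a" "a \<in> carrier A"
  shows "\<exists>j\<in>J. b = a \<oplus>\<^bsub>R\<^esub> j" "b \<in> carrier A" "coset b = coset a"
proof -
  obtain j where "j \<in> J" "b = j \<oplus>\<^bsub>R\<^esub> a"
    using assms(1) by (auto simp: a_r_coset_def')
  then show "\<exists>j\<in>J. b = a \<oplus>\<^bsub>R\<^esub> j" "b \<in> carrier A"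
    using assms(2) in_carrier alg.a_comm[of j a] alg.a_closed[of j a] by auto
  show "coset b = coset a"
    using alg.a_repr_independence[OF assms(1)] assms(2) a_subgroup by simp
qed

lemma coset_self: "a \<in> carrier A \<Longrightarrow> a \<in> coset a"
  using a_rcos_self by simp

lemma coset_add: "j \<in> J \<Longrightarrow> a \<in> carrier A \<Longrightarrow> coset (a \<oplus>\<^bsub>R\<^esub> j) = coset a"
  using in_carrier by (intro coset_memD(3)) (auto simp: a_r_coset_def' intro!: bexI alg.a_comm)

lemma representatives_in_carrier:
  assumes "list_all2 (\<in>) bs (map coset as)" "set as \<subseteq> carrier A"
  shows "set bs \<subseteq> carrier A"
proof
  fix b assume "b \<in> set bs"
  then obtain i where i: "i < length bs" "b = bs ! i" by (metis in_set_conv_nth)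
  have len: "length bs = length as" using assms(1) by (auto dest: list_all2_lengthD)
  have "b \<in> coset (as ! i)"
    using list_all2_nthD[OF assms(1) i(1)] i len by simp
  moreover have "as ! i \<in> carrier A"
    using assms(2) i(1) len by auto
  ultimately show "b \<in> carrier A" by (rule coset_memD(2))
qed

text \<open>The arguments are replaced one after the other, and each replacement is a perturbation by an element
  of \<open>J\<close>.\<close>
lemma cop_coset_cong:
  assumes f: "f \<in> Cinf (length as)" and as: "set as \<subseteq> carrier A"
    and bs: "list_all2 (\<in>) bs (map coset as)"
  shows "coset (cop A f bs) = coset (cop A f as)"
proof -
  have len: "length bs = length as" using bs by (auto dest: list_all2_lengthD)
  have nth: "bs ! i \<in> coset (as ! i)" if "i < length as" for i
    using list_all2_nthD2[OF bs, of i] that by simp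
  have asA: "as ! i \<in> carrier A" if "i < length as" for i using as that by auto
  note mem = coset_memD(1)[OF nth asA]
  have bsA: "set bs \<subseteq> carrier A" using bs as by (rule representatives_in_carrier)
  have "coset (cop A f (take k bs @ drop k as)) = coset (cop A f as)" if "k \<le> length as" for k
    using that
  proof (induction k)
    case (Suc k)
    define cs where "cs = take k bs @ drop k as"
    have k: "k < length as" using Suc.prems by simp
    have cs: "length cs = length as" "cs ! k = as ! k" "set cs \<subseteq> carrier A"
      using k len as bsA by (auto simp: cs_def nth_append dest: in_set_takeD in_set_dropD)
    obtain j where j: "j \<in> J" "bs ! k = as ! k \<oplus>\<^bsub>R\<^esub> j" using mem[OF k k] by blast
    have upd: "take (Suc k) bs @ drop (Suc k) as = cs[k := cs ! k \<oplus>\<^bsub>R\<^esub> j]"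
      using k len j(2) cs(2)
      by (intro nth_equalityI) (auto simp: cs_def nth_append nth_list_update less_Suc_eq)
    obtain d where d: "d \<in> carrier A"
      "cop A f (cs[k := cs ! k \<oplus>\<^bsub>R\<^esub> j]) = cop A f cs \<oplus>\<^bsub>R\<^esub> j \<otimes>\<^bsub>R\<^esub> d"
      using cop_perturb[of f cs j k] f cs k in_carrier[OF j(1)] by auto
    have "coset (cop A f (cs[k := cs ! k \<oplus>\<^bsub>R\<^esub> j])) = coset (cop A f cs)"
      unfolding d(2) using j d(1) f cs by (intro coset_add I_r_closed cop_closed) auto
    then show ?case
      using Suc by (simp add: upd cs_def)
  qed simp
  from this[of "length as"] show ?thesis using len by simp
qed

lemma bracket_coset_cong:
  assumes a: "a \<in> carrier A" and b: "b \<in> carrier A" and "a' \<in> coset a" "b' \<in> coset b"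
  shows "coset (bracket A a' b') = coset (bracket A a b)"
proof -
  obtain j where j: "j \<in> J" "a' = a \<oplus>\<^bsub>R\<^esub> j" using coset_memD(1)[OF assms(3) a] by blast
  obtain l where l: "l \<in> J" "b' = b \<oplus>\<^bsub>R\<^esub> l" using coset_memD(1)[OF assms(4) b] by blast
  have a'A: "a' \<in> carrier A" using coset_memD(2)[OF assms(3) a] .
  note carr = a b a'A in_carrier[OF j(1)] in_carrier[OF l(1)]
  have "bracket A a' l = \<ominus>\<^bsub>R\<^esub> bracket A l a'"
    using carr by (intro br_skew) simp_all
  then have al: "bracket A a' l \<in> J"
    using bracket_ideal[OF l(1) a'A] by (simp add: a_inv_closed)
  have ab: "bracket A a b \<in> carrier A" "bracket A a' b \<in> carrier A"
    using br_closed carr by simp_all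
  have "bracket A a' b' = bracket A a' b \<oplus>\<^bsub>R\<^esub> bracket A a' l"
    unfolding l(2) using carr by (intro br_add_right) simp_all
  moreover have "bracket A a' b = bracket A a b \<oplus>\<^bsub>R\<^esub> bracket A j b"
    unfolding j(2) using carr by (intro br_add_left) simp_all
  ultimately show ?thesis
    using coset_add[OF al ab(2)] coset_add[OF bracket_ideal[OF j(1) b] ab(1)] by simp
qed

lemma quot_carrier: "carrier Q = coset ` carrier A"
  by (auto simp: poisson_quot_def A_RCOSETS_def')

lemma quot_cop_eqI:
  assumes "list_all2 (\<in>) as Xs" "\<And>bs. list_all2 (\<in>) bs Xs \<Longrightarrow> coset (cop A f bs) = X"
  shows "cop Q f Xs = X"
proof -
  have "cop Q f Xs = (\<Union>bs\<in>{bs. list_all2 (\<in>) bs Xs}. coset (cop A f bs))"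
    by (simp add: poisson_quot_def)
  also have "\<dots> = X"
    using assms by (intro UN_constant_eq[of as]) auto
  finally show ?thesis .
qed

lemma quot_cop:
  assumes "f \<in> Cinf (length as)" "set as \<subseteq> carrier A"
  shows "cop Q f (map coset as) = coset (cop A f as)"
proof (rule quot_cop_eqI[OF _ cop_coset_cong[OF assms]])
  show "list_all2 (\<in>) as (map coset as)"
    using assms(2) by (auto simp: list_all2_conv_all_nth intro!: coset_self)
qed

lemma quot_bracket:
  assumes "a \<in> carrier A" "b \<in> carrier A"
  shows "bracket Q (coset a) (coset b) = coset (bracket A a b)"
proof -
  have "bracket Q (coset a) (coset b) = (\<Union>a'\<in>coset a. \<Union>b'\<in>coset b. coset (bracket A a' b'))"
    by (simp add: poisson_quot_def)
  also have "\<dots> = coset (bracket A a b)"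
    by (intro UN_constant_eq[OF coset_self] ballI bracket_coset_cong assms)
  finally show ?thesis .
qed

lemma lift_args:
  assumes "set Xs \<subseteq> carrier Q"
  obtains as where "set as \<subseteq> carrier A" "Xs = map coset as"
proof -
  have "Xs \<in> map coset ` lists (carrier A)"
    using assms by (simp add: lists_image[symmetric] in_lists_conv_set subset_iff quot_carrier)
  with that show ?thesis by auto
qed

lemma quot_cinf_ring: "cinf_ring Q"
proof
  fix f :: "(nat \<Rightarrow> real) \<Rightarrow> real" and Xs assume f: "f \<in> Cinf (length Xs)" and Xs: "set Xs \<subseteq> carrier Q"
  from Xs obtain as where as: "set as \<subseteq> carrier A" "Xs = map coset as" by (rule lift_args)
  show "cop Q f Xs \<in> carrier Q"
    using f as by (simp add: quot_cop quot_carrier cop_closed)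
next
  fix Xs i assume i: "i < length Xs" and Xs: "set Xs \<subseteq> carrier Q"
  from Xs obtain as where as: "set as \<subseteq> carrier A" "Xs = map coset as" by (rule lift_args)
  show "cop Q (\<lambda>x. x i) Xs = Xs ! i"
    using i as by (simp add: quot_cop cop_coord Cinf_coord)
next
  fix f and gs :: "((nat \<Rightarrow> real) \<Rightarrow> real) list" and Xs
  assume f: "f \<in> Cinf (length gs)" and gs: "set gs \<subseteq> Cinf (length Xs)" and Xs: "set Xs \<subseteq> carrier Q"
  from Xs obtain as where as: "set as \<subseteq> carrier A" "Xs = map coset as" by (rule lift_args)
  have vals_eq: "map (\<lambda>g. cop Q g Xs) gs = map coset (map (\<lambda>g. cop A g bs) gs)"
    if bs: "list_all2 (\<in>) bs Xs" for bs
  proof -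
    have "cop Q g Xs = coset (cop A g bs)" if "g \<in> set gs" for g
      using cop_coset_cong[of g as bs] quot_cop[of g as] as gs bs that by auto
    then show ?thesis by simp
  qed
  \<comment> \<open>Composition is evaluated at each list of representatives separately; the values \<open>cop A g bs\<close> are
    then representatives of the values in the quotient, so that independence for \<open>f\<close> and the \<open>g\<close>
    gives independence for the composite without an appeal to its smoothness.\<close>
  have comp: "coset (cop A (\<lambda>x. f (\<lambda>i. (gs ! i) x)) bs) = cop Q f (map (\<lambda>g. cop Q g Xs) gs)"
    if bs: "list_all2 (\<in>) bs Xs" for bs
  proof -
    have len: "length bs = length Xs" using bs by (auto dest: list_all2_lengthD)
    have bsA: "set bs \<subseteq> carrier A"
      using bs as representatives_in_carrier by blast
    have vals: "set (map (\<lambda>g. cop A g bs) gs) \<subseteq> carrier A"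
      using bsA gs len by (auto intro!: cop_closed)
    have "cop A (\<lambda>x. f (\<lambda>i. (gs ! i) x)) bs = cop A f (map (\<lambda>g. cop A g bs) gs)"
      using f gs len bsA by (intro cop_comp[symmetric]) auto
    also have "coset \<dots> = cop Q f (map coset (map (\<lambda>g. cop A g bs) gs))"
      by (rule quot_cop[symmetric, OF _ vals]) (simp add: f)
    finally show ?thesis by (simp only: vals_eq[OF bs])
  qed
  have "list_all2 (\<in>) as Xs"
    using as by (auto simp: list_all2_conv_all_nth intro!: coset_self)
  from quot_cop_eqI[OF this comp]
  show "cop Q f (map (\<lambda>g. cop Q g Xs) gs) = cop Q (\<lambda>x. f (\<lambda>i. (gs ! i) x)) Xs"
    by simp
qed

lemma quot_poisson_cinf_ring: "poisson_cinf_ring Q"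
proof (rule poisson_cinf_ring_image[where h=coset])
  show "poisson_cinf_ring A" by unfold_locales
  show "cinf_hom coset A Q"
    by (auto simp: cinf_hom_def quot_carrier quot_cop)
qed (simp_all add: quot_cinf_ring quot_carrier quot_bracket)

end

section \<open>Poisson reduction\<close>

theorem lemma2p20:
  fixes A :: "('a, 'b) poisson_struct_scheme" and I :: "'a set"
  assumes "poisson_cinf_ring A"
    and "ideal I (cinf_alg A)"
  defines "N \<equiv> normalizer A I"
  defines "J \<equiv> I \<inter> N"
  defines "NA \<equiv> A\<lparr>carrier := N\<rparr>"
  defines "B \<equiv> poisson_quot NA J"
  shows "cinf_subring N A \<and>
    ideal J (cinf_alg NA) \<and>
    poisson_cinf_ring B \<and>
    (\<forall>f as. f \<in> Cinf (length as) \<longrightarrow> set as \<subseteq> N \<longrightarrow>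
       cop B f (map (\<lambda>a. J +>\<^bsub>cinf_alg NA\<^esub> a) as) = J +>\<^bsub>cinf_alg NA\<^esub> cop A f as) \<and>
    (\<forall>a\<in>N. \<forall>b\<in>N.
       bracket B (J +>\<^bsub>cinf_alg NA\<^esub> a) (J +>\<^bsub>cinf_alg NA\<^esub> b) = J +>\<^bsub>cinf_alg NA\<^esub> bracket A a b)"
proof -
  interpret A: poisson_cinf_ring A by fact
  interpret I: ideal I "cinf_alg A" by fact
  have sub: "cinf_subring N A"
    unfolding N_def by (rule A.normalizer_cinf_subring[OF assms(2)])
  have br: "bracket A a b \<in> N" if "a \<in> N" "b \<in> N" for a b
    using that unfolding N_def by (rule A.normalizer_bracket_closed[OF assms(2)])
  interpret NA: poisson_cinf_ring NA
    unfolding NA_def by (rule poisson_subring[OF assms(1) sub br])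
  have NA_simps: "carrier NA = N" "cop NA = cop A" "bracket NA = bracket A"
    by (simp_all add: NA_def)
  have "N \<subseteq> carrier A" by (auto simp: N_def normalizer_def)
  then have "cinf_hom (\<lambda>a. a) NA A" by (simp add: cinf_hom_def NA_simps)
  then have "ring_hom_cring (cinf_alg NA) (cinf_alg A) (\<lambda>a. a)"
    by (intro cinf_hom_ring_hom NA.cinf_ring_axioms A.cinf_ring_axioms)
  then have "ring_hom_ring (cinf_alg NA) (cinf_alg A) (\<lambda>a. a)"
    by (intro ring_hom_ringI2 ring_hom_cring.homh NA.alg.ring_axioms A.alg.ring_axioms)
  \<comment> \<open>\<open>J\<close> is the preimage of \<open>I\<close> under the inclusion of the normalizer\<close>
  from ring_hom_ring.ideal_vimage[OF this assms(2)] have J: "ideal J (cinf_alg NA)"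
    by (simp add: J_def NA_simps Int_def conj_commute)
  have "poisson_ideal NA J"
  proof (intro poisson_ideal.intro poisson_ideal_axioms.intro J)
    show "poisson_cinf_ring NA" by unfold_locales
    \<comment> \<open>the bracket lies in \<open>I\<close> as \<open>a\<close> normalizes \<open>I\<close>, and in \<open>N\<close> as \<open>N\<close> is closed under the bracket\<close>
    show "bracket NA j a \<in> J" if "j \<in> J" "a \<in> carrier NA" for j a
      using that br unfolding NA_simps J_def by (auto simp: N_def normalizer_def)
  qed
  then interpret poisson_ideal NA J .
  show ?thesis
    using sub J quot_poisson_cinf_ring quot_cop quot_bracket
    unfolding B_def NA_simps by blast
qed

end
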